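(* Let $R$ be a finite commutative ring with identity. If $R$ has exactly $n$ maximal ideals, then the unit-zero divisor graph $G_{UZ}(R)$ is an $(n+1)$-partite graph.
   Context: For a finite commutative ring $R$ with identity, $U(R)$ is the set of units and $Z(R)$ is the set of zero divisors, with the convention $0\in Z(R)$. The unit-zero divisor graph $G_{UZ}(R)$ is the simple undirected graph whose vertex set is the set of all elements of $R$, where two distinct vertices $u,v$ are adjacent if and only if $u+v\in U(R)$ and $uv\in Z(R)$. A graph is $k$-partite if its vertex set can be partitioned into $k$ pairwise disjoint independent sets (sets in which no two vertices are adjacent). *)

theory Defs
  imports
    "HOL-Algebra.Ideal"
    "HOL-Library.Disjoint_Sets"
    "Graph_Theory.Pair_Digraph"
begin

text \<open>The disjunct \<open>x = \<zero>\<close> is redundant except in the zero ring, where it enforces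
  the convention that zero is a zero divisor.\<close>

definition zero_divisors :: "('a, 'm) ring_scheme \<Rightarrow> 'a set" where
  "zero_divisors R =
     {x \<in> carrier R. x = \<zero>\<^bsub>R\<^esub> \<or> (\<exists>y \<in> carrier R. y \<noteq> \<zero>\<^bsub>R\<^esub> \<and> x \<otimes>\<^bsub>R\<^esub> y = \<zero>\<^bsub>R\<^esub>)}"

text \<open>An undirected graph is represented, as usual in \<^theory>\<open>Graph_Theory.Digraph\<close>,
  by a symmetric digraph.\<close>

definition unit_zero_divisor_graph :: "('a, 'm) ring_scheme \<Rightarrow> 'a pair_pre_digraph" where
  "unit_zero_divisor_graph R =
     \<lparr> pverts = carrier R,
       parcs = {(u, v). u \<in> carrier R \<and> v \<in> carrier R \<and> u \<noteq> v \<and>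
                        u \<oplus>\<^bsub>R\<^esub> v \<in> Units R \<and> u \<otimes>\<^bsub>R\<^esub> v \<in> zero_divisors R} \<rparr>"

lemma (in cring) unit_zero_divisor_graph_pair_graph:
  assumes "finite (carrier R)"
  shows "pair_graph (unit_zero_divisor_graph R)"
proof -
  have "finite (parcs (unit_zero_divisor_graph R))"
    by (rule finite_subset[of _ "carrier R \<times> carrier R"])
      (auto simp: unit_zero_divisor_graph_def assms)
  moreover have "sym (parcs (unit_zero_divisor_graph R))"
    by (auto simp: unit_zero_divisor_graph_def sym_def a_comm m_comm)
  ultimately show ?thesis
    by unfold_locales (auto simp: unit_zero_divisor_graph_def assms symmetric_def)
qed

definition independent_set :: "'a pair_pre_digraph \<Rightarrow> 'a set \<Rightarrow> bool" where
  "independent_set G A \<longleftrightarrow> A \<subseteq> pverts G \<and> (\<forall>u \<in> A. \<forall>v \<in> A. (u, v) \<notin> parcs G)"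

text \<open>By \<^const>\<open>partition_on\<close> the \<open>k\<close> parts are nonempty.\<close>

definition k_partite :: "nat \<Rightarrow> 'a pair_pre_digraph \<Rightarrow> bool" where
  "k_partite k G \<longleftrightarrow>
     (\<exists>P. partition_on (pverts G) P \<and> finite P \<and> card P = k \<and> (\<forall>A \<in> P. independent_set G A))"

end

theory Submission
  imports Defs
begin

text \<open>Colour a unit by \<open>None\<close> and a non-unit by some maximal ideal containing it. Two units have a
  unit as product, and two elements of a maximal ideal have a non-unit as sum, so every colour class
  is independent. All \<open>n + 1\<close> colours occur: by primality and maximality, each maximal ideal
  contains an element lying in no other maximal ideal, whose colour is therefore forced.\<close>

lemma (in ideal) Units_not_in_proper:
  assumes "I \<noteq> carrier R"
  shows "Units R \<inter> I = {}"
proof (rule ccontr)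
  assume "Units R \<inter> I \<noteq> {}"
  then obtain u where u: "u \<in> Units R" "u \<in> I" by blast
  then have "inv u \<otimes> u \<in> I" by (intro I_l_closed) auto
  then show False using u one_imp_carrier assms by simp
qed

lemma (in ring) finite_ideals:
  assumes "finite (carrier R)"
  shows "finite {I. ideal I R}"
  by (rule finite_subset[of _ "Pow (carrier R)"]) (auto simp: assms dest: ideal.Icarr)

lemma (in ring) finite_maximalideals:
  assumes "finite (carrier R)"
  shows "finite {M. maximalideal M R}"
  by (rule finite_subset[OF _ finite_ideals[OF assms]]) (auto dest: maximalideal.axioms(1))

text \<open>A finite ring has only finitely many ideals, so a maximal element among the proper
  ideals containing \<open>PIdl x\<close> exists by finiteness alone, without Zorn's lemma.\<close>

lemma (in cring) nonunit_in_maximalideal: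
  assumes fin: "finite (carrier R)" and x: "x \<in> carrier R" "x \<notin> Units R"
  shows "\<exists>M. maximalideal M R \<and> x \<in> M"
proof -
  let ?\<I> = "{I. ideal I R \<and> I \<noteq> carrier R}"
  have "PIdl x \<in> ?\<I>"
  proof -
    \<comment> \<open>If \<open>\<one>\<close> were a multiple of \<open>x\<close>, the cofactor
      would be an inverse of \<open>x\<close>.\<close>
    have "\<one> \<notin> PIdl x"
      using x by (auto simp: cgenideal_def Units_def m_comm)
    then show ?thesis using cgenideal_ideal[OF x(1)] by auto
  qed
  moreover have "finite ?\<I>"
    by (rule finite_subset[OF _ finite_ideals[OF fin]]) auto
  ultimately have "\<exists>M \<in> ?\<I>. PIdl x \<subseteq> M \<and> (\<forall>J \<in> ?\<I>. M \<subseteq> J \<longrightarrow> M = J)"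
    by (intro finite_has_maximal2)
  then obtain M where M: "M \<in> ?\<I>" "PIdl x \<subseteq> M"
    and max: "\<forall>J \<in> ?\<I>. M \<subseteq> J \<longrightarrow> M = J"
    by (elim bexE conjE)
  have "maximalideal M R"
    using M max by (intro maximalidealI) auto
  then show ?thesis using M(2) cgenideal_self[OF x(1)] by blast
qed

text \<open>Prime avoidance in product form: multiply together one element of \<open>J\<close>
  outside \<open>M\<close> for each \<open>J\<close> in \<open>S\<close>. The product lies in every
  \<open>J\<close>, and stays outside \<open>M\<close> because \<open>M\<close> is prime.\<close>

lemma (in cring) maximalideal_avoid:
  assumes M: "maximalideal M R" and "finite S"
    and "\<And>J. J \<in> S \<Longrightarrow> maximalideal J R \<and> J \<noteq> M"
  shows "\<exists>x \<in> carrier R. x \<notin> M \<and> (\<forall>J \<in> S. x \<in> J)"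
  using assms(2,3)
proof (induction S rule: finite_induct)
  case empty
  interpret M: maximalideal M R by (rule M)
  have "\<one> \<notin> M" using M.one_imp_carrier M.I_notcarr by blast
  then show ?case by auto
next
  case (insert J S)
  interpret M: primeideal M R by (rule maximalideal_prime[OF M])
  interpret J: maximalideal J R using insert.prems by blast
  obtain x where x: "x \<in> carrier R" "x \<notin> M" "\<forall>J \<in> S. x \<in> J"
    using insert by blast
  \<comment> \<open>Distinct maximal ideals are incomparable; this supplies the new factor
    \<open>y\<close>.\<close>
  have "\<not> J \<subseteq> M"
  proof
    assume "J \<subseteq> M"
    then have "M = J \<or> M = carrier R"
      by (intro J.I_maximal M.is_ideal) auto
    then show False using insert.prems M.I_notcarr by blast
  qed
  then obtain y where y: "y \<in> J" "y \<notin> M" by blast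
  have yc: "y \<in> carrier R" using y(1) by simp
  have "x \<otimes> y \<notin> M" using M.I_prime x y yc by blast
  moreover have "x \<otimes> y \<in> J" using J.I_l_closed x y by blast
  moreover have "\<forall>K \<in> S. x \<otimes> y \<in> K"
  proof
    fix K assume K: "K \<in> S"
    interpret K: maximalideal K R using insert.prems K by blast
    show "x \<otimes> y \<in> K" using K.I_r_closed x(3) K yc by blast
  qed
  ultimately show ?case using x(1) yc by blast
qed

text \<open>Take \<open>x\<close> outside \<open>M\<close> but in all other maximal ideals.
  Maximality of \<open>M\<close> gives \<open>\<one> = y \<oplus> a \<otimes> x\<close> with
  \<open>y\<close> in \<open>M\<close>. A maximal ideal other than \<open>M\<close> contains
  \<open>a \<otimes> x\<close>, so it cannot contain \<open>y\<close> without containing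
  \<open>\<one>\<close>.\<close>

lemma (in cring) maximalideal_private_element:
  assumes fin: "finite (carrier R)" and M: "maximalideal M R"
  shows "\<exists>y \<in> M. \<forall>J. maximalideal J R \<longrightarrow> y \<in> J \<longrightarrow> J = M"
proof -
  interpret M: maximalideal M R by (rule M)
  let ?S = "{J. maximalideal J R \<and> J \<noteq> M}"
  have "finite ?S"
    by (rule finite_subset[OF _ finite_maximalideals[OF fin]]) auto
  then obtain x where x: "x \<in> carrier R" "x \<notin> M" "\<forall>J \<in> ?S. x \<in> J"
    using maximalideal_avoid[OF M, of ?S] by blast
  have idl: "ideal (M <+>\<^bsub>R\<^esub> PIdl x) R"
    by (intro add_ideals M.is_ideal cgenideal_ideal x)
  have sub: "M \<subseteq> M <+>\<^bsub>R\<^esub> PIdl x"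
  proof
    fix m assume "m \<in> M"
    moreover have "\<zero> \<in> PIdl x"
      using cgenideal_ideal[OF x(1)] by (simp add: additive_subgroup.zero_closed ideal.axioms(1))
    ultimately have "m \<oplus> \<zero> \<in> M <+>\<^bsub>R\<^esub> PIdl x"
      unfolding set_add_def' by blast
    then show "m \<in> M <+>\<^bsub>R\<^esub> PIdl x" using \<open>m \<in> M\<close> by simp
  qed
  \<comment> \<open>The element \<open>x\<close> witnesses that the sum ideal is strictly larger
    than \<open>M\<close>.\<close>
  have "\<zero> \<oplus> x \<in> M <+>\<^bsub>R\<^esub> PIdl x"
    using cgenideal_self[OF x(1)] M.zero_closed unfolding set_add_def' by blast
  then have "M <+>\<^bsub>R\<^esub> PIdl x \<noteq> M" using x(1,2) by auto
  moreover have "M <+>\<^bsub>R\<^esub> PIdl x \<subseteq> carrier R" using ideal.Icarr[OF idl] by blast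
  ultimately have "M <+>\<^bsub>R\<^esub> PIdl x = carrier R"
    using M.I_maximal[OF idl sub] by blast
  then have "\<one> \<in> M <+>\<^bsub>R\<^esub> PIdl x" by simp
  then obtain y a where y: "y \<in> M" and a: "a \<in> carrier R" and eq: "\<one> = y \<oplus> a \<otimes> x"
    by (auto simp: set_add_def' cgenideal_def)
  have "J = M" if J: "maximalideal J R" and "y \<in> J" for J
  proof (rule ccontr)
    interpret J: maximalideal J R by (rule J)
    assume "J \<noteq> M"
    then have "a \<otimes> x \<in> J" using x(3) J a J.I_l_closed by blast
    then have "\<one> \<in> J" using \<open>y \<in> J\<close> eq by simp
    then show False using J.one_imp_carrier J.I_notcarr by blast
  qed
  then show ?thesis using y by blast
qed

text \<open>Units can be cancelled, so a unit is a zero divisor only in the zero ring. Concluding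
  \<open>\<one> = \<zero>\<close> rather than a contradiction keeps that ring covered.\<close>

lemma (in cring) Units_zero_divisors_eq_zero:
  assumes "u \<in> Units R" "u \<in> zero_divisors R"
  shows "\<one> = \<zero>"
proof -
  from assms(2) consider "u = \<zero>" | y where "y \<in> carrier R" "y \<noteq> \<zero>" "u \<otimes> y = \<zero>"
    by (auto simp: zero_divisors_def)
  then show ?thesis
  proof cases
    case 1
    then show ?thesis using assms(1) Units_l_inv[of u] by (auto simp: Units_def)
  next
    case 2
    have "y = inv u \<otimes> (u \<otimes> y)"
      using assms(1) 2(1) by (simp add: m_assoc[symmetric] Units_closed)
    then show ?thesis using 2 assms(1) by simp
  qed
qed

text \<open>A product of units is a unit, hence a zero divisor only in the zero ring. There the
  graph has a single vertex, and loops are excluded by definition.\<close>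

lemma (in cring) independent_set_Units:
  "independent_set (unit_zero_divisor_graph R) (Units R)"
proof -
  have "u = v" if "u \<in> Units R" "v \<in> Units R" "u \<otimes> v \<in> zero_divisors R" for u v
  proof -
    have "carrier R = {\<zero>}"
      using Units_zero_divisors_eq_zero[of "u \<otimes> v"] that one_zeroD by simp
    then show ?thesis using that(1,2) Units_closed by auto
  qed
  then show ?thesis by (auto simp: independent_set_def unit_zero_divisor_graph_def)
qed

text \<open>Sums of elements of \<open>A\<close> stay in the proper ideal \<open>I\<close>, which
  contains no unit. A subset \<open>A\<close> is allowed because an element of several maximal
  ideals is coloured by only one of them.\<close>

lemma (in ideal) independent_set_proper:
  assumes "I \<noteq> carrier R" "A \<subseteq> I"
  shows "independent_set (unit_zero_divisor_graph R) A"
proof -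
  have "u \<oplus> v \<notin> Units R" if "u \<in> A" "v \<in> A" for u v
    using that assms(2) a_closed[of u v] Units_not_in_proper[OF assms(1)] by blast
  moreover have "A \<subseteq> carrier R" using assms(2) a_subset by blast
  ultimately show ?thesis
    by (simp add: independent_set_def unit_zero_divisor_graph_def)
qed

text \<open>Since \<open>c\<close> hits every colour in \<open>C\<close>, the colour classes are
  nonempty and pairwise distinct, so there are exactly \<open>card C\<close> parts and not merely at
  most that many.\<close>

lemma k_partite_by_colouring:
  assumes "finite C" and onto: "c ` pverts G = C"
    and indep: "\<And>k. k \<in> C \<Longrightarrow> independent_set G {x \<in> pverts G. c x = k}"
  shows "k_partite (card C) G"
proof -
  let ?F = "\<lambda>k. {x \<in> pverts G. c x = k}"
  have "inj_on ?F C" using onto by (fastforce simp: inj_on_def)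
  then have "card (?F ` C) = card C" by (rule card_image)
  moreover have "partition_on (pverts G) (?F ` C)"
    using onto by (auto simp: partition_on_def disjoint_def)
  ultimately show ?thesis
    unfolding k_partite_def using assms(1) indep by blast
qed

theorem theorem3p13:
  fixes R :: "('a, 'm) ring_scheme" and n :: nat
  assumes "cring R"
    and "finite (carrier R)"
    and "card {I. maximalideal I R} = n"
  shows "k_partite (n + 1) (unit_zero_divisor_graph R)"
proof -
  interpret cring R by (rule assms(1))
  let ?Max = "{I. maximalideal I R}" and ?G = "unit_zero_divisor_graph R"
  let ?C = "insert None (Some ` ?Max)"
  have V: "pverts ?G = carrier R" by (simp add: unit_zero_divisor_graph_def)
  \<comment> \<open>The choice among the maximal ideals containing a non-unit is arbitrary; an
    element with only one such ideal leaves no freedom.\<close>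
  define c where
    "c x = (if x \<in> Units R then None else Some (SOME M. maximalideal M R \<and> x \<in> M))" for x
  have cE: "\<exists>M. c x = Some M \<and> maximalideal M R \<and> x \<in> M"
    if "x \<in> carrier R" "x \<notin> Units R" for x
    using someI_ex[OF nonunit_in_maximalideal[OF assms(2) that]] that by (simp add: c_def)
  have c_None: "c x = None \<longleftrightarrow> x \<in> Units R" for x by (simp add: c_def)
  have fin: "finite ?Max" by (rule finite_maximalideals[OF assms(2)])
  have "k_partite (card ?C) ?G"
  proof (rule k_partite_by_colouring)
    show "finite ?C" using fin by simp
    have "Some M \<in> c ` carrier R" if M: "maximalideal M R" for M
    proof -
      interpret M: maximalideal M R by (rule M)
      obtain y where y: "y \<in> M" "\<And>J. maximalideal J R \<Longrightarrow> y \<in> J \<Longrightarrow> J = M"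
        using maximalideal_private_element[OF assms(2) M] by blast
      then have "y \<in> carrier R" "y \<notin> Units R"
        using M.Units_not_in_proper[OF M.I_notcarr[symmetric]] by auto
      then show ?thesis using cE y(2) by (metis image_eqI)
    qed
    moreover have "None \<in> c ` carrier R"
      using c_None[of "\<one>\<^bsub>R\<^esub>"] by (metis Units_one_closed image_eqI one_closed)
    moreover have "c ` carrier R \<subseteq> ?C"
    proof (rule image_subsetI)
      fix x assume "x \<in> carrier R"
      then show "c x \<in> ?C" using cE[of x] c_None[of x] by (cases "x \<in> Units R") auto
    qed
    ultimately show "c ` pverts ?G = ?C" unfolding V by blast
  next
    fix k assume "k \<in> ?C"
    then consider "k = None" | M where "k = Some M" "maximalideal M R" by blast
    then show "independent_set ?G {x \<in> pverts ?G. c x = k}"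
    proof cases
      case 1
      then have "{x \<in> pverts ?G. c x = k} = Units R" by (auto simp: V c_None)
      then show ?thesis using independent_set_Units by simp
    next
      case 2
      interpret M: maximalideal M R by (rule 2)
      have "{x \<in> pverts ?G. c x = k} \<subseteq> M"
      proof
        fix x assume "x \<in> {x \<in> pverts ?G. c x = k}"
        then have x: "x \<in> carrier R" "c x = Some M" by (simp_all add: V 2(1))
        then have "x \<notin> Units R" using c_None[of x] by simp
        then show "x \<in> M" using cE[of x] x by auto
      qed
      then show ?thesis by (rule M.independent_set_proper[OF M.I_notcarr[symmetric]])
    qed
  qed
  moreover have "card ?C = n + 1"
    using fin assms(3) by (simp add: card_image)
  ultimately show ?thesis by simp
qed

end
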